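(* Let $G$ be an $n$-dimensional solvable Lie group equipped with a left-invariant metric, let $\langle\cdot,\cdot\rangle$ be the corresponding inner product on its Lie algebra $\mathfrak{g}$, let $\mathfrak{g}=\mathfrak{g}_0\supset\mathfrak{g}_1\supset\dots\supset\mathfrak{g}_n=\{0\}$ be a chain of subalgebras with $\mathfrak{g}_r$ an ideal of codimension $1$ in $\mathfrak{g}_{r-1}$ for $1\le r\le n$, and let $\{e_1,\dots,e_n\}$ be an orthonormal basis adapted to it, with $c_{ij}^k=\langle [e_i,e_j],e_k\rangle$. The following conditions are equivalent: (i) $G$ (with the given left-invariant metric) is a cyclic metric Lie group. (ii) $c_{ik}^{j}=c_{jk}^{i}$ for all $1\le i<j<k\le n$. (iii) $\operatorname{ad}_{e_i}$ is selfadjoint on $\mathfrak{g}_{n-i}$ for all $i=1,\dots,n$.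
   Context: The left-invariant metric (or the metric Lie group) is called cyclic if $\langle [X,Y],Z\rangle+\langle [Y,Z],X\rangle+\langle [Z,X],Y\rangle=0$ for all $X,Y,Z\in\mathfrak{g}$. Since $\mathfrak{g}$ is a real solvable Lie algebra of dimension $n$, chains $\mathfrak{g}=\mathfrak{g}_0\supset\dots\supset\mathfrak{g}_n=\{0\}$ as in the claim exist. An orthonormal basis $\{e_1,\dots,e_n\}$ of $(\mathfrak{g},\langle\cdot,\cdot\rangle)$ is adapted to the chain if $\mathfrak{g}_{n-i}=\mathbb{R}\{e_1,\dots,e_i\}$ (the linear span) for $i=1,\dots,n$. *)

theory Defs
  imports "HOL-Analysis.Analysis" "HOL-Algebra.Group" "HOL-Library.Function_Algebras"
begin

text \<open>Pointwise real vector space structure on functions; together with the pointwise ring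
  operations of \<^theory>\<open>HOL-Library.Function_Algebras\<close> it makes \<^const>\<open>subspace\<close>,
  \<^const>\<open>span\<close> and \<^const>\<open>dim\<close> available for spaces of derivations.\<close>

instantiation "fun" :: (type, real_vector) real_vector
begin

definition scaleR_fun_def: "c *\<^sub>R f = (\<lambda>x. c *\<^sub>R f x)"

instance
  by standard
    (simp_all add: scaleR_fun_def plus_fun_def fun_eq_iff scaleR_add_right scaleR_add_left)

end

section \<open>Smooth manifolds\<close>

text \<open>A real function is \<open>C\<^sup>\<infinity>\<close> on an open set \<open>U\<close> of \<open>\<real>\<^sup>n\<close>
  (the space \<^term>\<open>Euclidean_space n\<close>, whose points vanish from index \<open>n\<close> on) if it is continuous
  on \<open>U\<close> and has all partial derivatives there, each of them again \<open>C\<^sup>\<infinity>\<close> on \<open>U\<close>; read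
  coinductively, partial derivatives of every order exist and are continuous.\<close>

coinductive smooth_real :: "nat \<Rightarrow> (nat \<Rightarrow> real) set \<Rightarrow> ((nat \<Rightarrow> real) \<Rightarrow> real) \<Rightarrow> bool"
  for n U where
  "\<lbrakk>continuous_map (subtopology (Euclidean_space n) U) euclideanreal f;
    \<forall>i<n. \<exists>d. (\<forall>x\<in>U. ((\<lambda>t. f (x(i := t))) has_real_derivative d x) (at (x i))) \<and> smooth_real n U d\<rbrakk>
   \<Longrightarrow> smooth_real n U f"

type_synonym 'a chart = "'a set \<times> ('a \<Rightarrow> nat \<Rightarrow> real)"

definition is_chart :: "nat \<Rightarrow> 'a topology \<Rightarrow> 'a set \<Rightarrow> ('a \<Rightarrow> nat \<Rightarrow> real) \<Rightarrow> bool" where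
  "is_chart n T V \<phi> \<longleftrightarrow>
     openin T V \<and> openin (Euclidean_space n) (\<phi> ` V) \<and>
     homeomorphic_map (subtopology T V) (subtopology (Euclidean_space n) (\<phi> ` V)) \<phi>"

text \<open>A smooth structure is given by any smooth atlas; maximality of the atlas is not required.\<close>

definition smooth_manifold :: "nat \<Rightarrow> 'a topology \<Rightarrow> 'a chart set \<Rightarrow> bool" where
  "smooth_manifold n T A \<longleftrightarrow>
     Hausdorff_space T \<and> second_countable T \<and>
     (\<forall>(V, \<phi>)\<in>A. is_chart n T V \<phi>) \<and>
     (\<Union>(V, \<phi>)\<in>A. V) = topspace T \<and>
     (\<forall>(V, \<phi>)\<in>A. \<forall>(W, \<psi>)\<in>A. \<forall>k<n.
        smooth_real n (\<phi> ` (V \<inter> W)) (\<lambda>x. \<psi> (inv_into V \<phi> x) k))"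

definition prod_atlas :: "nat \<Rightarrow> 'a chart set \<Rightarrow> 'b chart set \<Rightarrow> ('a \<times> 'b) chart set" where
  "prod_atlas m A B =
     {(V \<times> W, \<lambda>(x, y) i. if i < m then \<phi> x i else \<psi> y (i - m)) | V \<phi> W \<psi>.
        (V, \<phi>) \<in> A \<and> (W, \<psi>) \<in> B}"

definition smooth_map ::
  "nat \<Rightarrow> 'a topology \<Rightarrow> 'a chart set \<Rightarrow> nat \<Rightarrow> 'b topology \<Rightarrow> 'b chart set \<Rightarrow> ('a \<Rightarrow> 'b) \<Rightarrow> bool"
  where
  "smooth_map m S A n T B F \<longleftrightarrow>
     continuous_map S T F \<and>
     (\<forall>(V, \<phi>)\<in>A. \<forall>(W, \<psi>)\<in>B. \<forall>k<n.
        smooth_real m (\<phi> ` (V \<inter> F -` W)) (\<lambda>x. \<psi> (F (inv_into V \<phi> x)) k))"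

section \<open>Lie groups\<close>

record 'a lie_group = "'a monoid" +
  dimen :: nat
  topo :: "'a topology"
  atlas :: "'a chart set"

definition is_lie_group :: "'a lie_group \<Rightarrow> bool" where
  "is_lie_group G \<longleftrightarrow>
     group G \<and> topspace (topo G) = carrier G \<and>
     smooth_manifold (dimen G) (topo G) (atlas G) \<and>
     smooth_map (dimen G + dimen G) (prod_topology (topo G) (topo G))
       (prod_atlas (dimen G) (atlas G) (atlas G))
       (dimen G) (topo G) (atlas G) (\<lambda>(x, y). x \<otimes>\<^bsub>G\<^esub> y) \<and>
     smooth_map (dimen G) (topo G) (atlas G) (dimen G) (topo G) (atlas G) (\<lambda>x. inv\<^bsub>G\<^esub> x)"

text \<open>\<open>C\<^sup>\<infinity>(G)\<close>. As usual for functions on a carrier set, a canonical value (here 0) is prescribed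
  outside the carrier; likewise derivations below are 0 on arguments outside \<open>C\<^sup>\<infinity>(G)\<close>.
  This makes equality of functions and of derivations the intended one.\<close>

definition smooth_funs :: "'a lie_group \<Rightarrow> ('a \<Rightarrow> real) set" where
  "smooth_funs G =
     {f. (\<forall>p. p \<notin> carrier G \<longrightarrow> f p = 0) \<and>
         (\<forall>(V, \<phi>)\<in>atlas G. smooth_real (dimen G) (\<phi> ` V) (\<lambda>x. f (inv_into V \<phi> x)))}"

definition tangent_space :: "'a lie_group \<Rightarrow> 'a \<Rightarrow> (('a \<Rightarrow> real) \<Rightarrow> real) set" where
  "tangent_space G p =
     {v. (\<forall>f. f \<notin> smooth_funs G \<longrightarrow> v f = 0) \<and>
         (\<forall>f\<in>smooth_funs G. \<forall>g\<in>smooth_funs G. v (f + g) = v f + v g) \<and>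
         (\<forall>c. \<forall>f\<in>smooth_funs G. v (c *\<^sub>R f) = c * v f) \<and>
         (\<forall>f\<in>smooth_funs G. \<forall>g\<in>smooth_funs G. v (f * g) = f p * v g + g p * v f)}"

text \<open>Smooth vector fields, as the operators they induce on \<open>C\<^sup>\<infinity>(G)\<close>; \<open>field_at X p\<close> is the
  tangent vector of the field at \<open>p\<close>.\<close>

type_synonym 'a vfield = "('a \<Rightarrow> real) \<Rightarrow> ('a \<Rightarrow> real)"

definition field_at :: "'a vfield \<Rightarrow> 'a \<Rightarrow> ('a \<Rightarrow> real) \<Rightarrow> real" where
  "field_at X p = (\<lambda>f. X f p)"

definition vector_fields :: "'a lie_group \<Rightarrow> 'a vfield set" where
  "vector_fields G =
     {X. (\<forall>f. f \<notin> smooth_funs G \<longrightarrow> X f = 0) \<and>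
         (\<forall>f\<in>smooth_funs G. X f \<in> smooth_funs G) \<and>
         (\<forall>p\<in>carrier G. field_at X p \<in> tangent_space G p)}"

text \<open>Pullback of functions along the left translation \<open>L\<^sub>a\<close>, and its differential.\<close>

definition left_pull :: "'a lie_group \<Rightarrow> 'a \<Rightarrow> ('a \<Rightarrow> real) \<Rightarrow> ('a \<Rightarrow> real)" where
  "left_pull G a f = (\<lambda>x. if x \<in> carrier G then f (a \<otimes>\<^bsub>G\<^esub> x) else 0)"

definition left_push ::
  "'a lie_group \<Rightarrow> 'a \<Rightarrow> (('a \<Rightarrow> real) \<Rightarrow> real) \<Rightarrow> ('a \<Rightarrow> real) \<Rightarrow> real" where
  "left_push G a v = (\<lambda>f. if f \<in> smooth_funs G then v (left_pull G a f) else 0)"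

text \<open>The Lie algebra consists of the left-invariant vector fields,
  \<open>dL\<^sub>a (X\<^sub>p) = X\<^sub>a\<^sub>p\<close>, with the commutator of vector fields as bracket.\<close>

definition lie_algebra :: "'a lie_group \<Rightarrow> 'a vfield set" where
  "lie_algebra G =
     {X \<in> vector_fields G. \<forall>a\<in>carrier G. \<forall>p\<in>carrier G.
        left_push G a (field_at X p) = field_at X (a \<otimes>\<^bsub>G\<^esub> p)}"

definition bracket :: "'a vfield \<Rightarrow> 'a vfield \<Rightarrow> 'a vfield" where
  "bracket X Y = (\<lambda>f. X (Y f) - Y (X f))"

section \<open>Subalgebras, ideals, solvability\<close>

definition lie_subalgebra :: "'a vfield set \<Rightarrow> 'a vfield set \<Rightarrow> bool" where
  "lie_subalgebra \<hh> \<gg> \<longleftrightarrow>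
     subspace \<hh> \<and> \<hh> \<subseteq> \<gg> \<and> (\<forall>X\<in>\<hh>. \<forall>Y\<in>\<hh>. bracket X Y \<in> \<hh>)"

definition lie_ideal :: "'a vfield set \<Rightarrow> 'a vfield set \<Rightarrow> bool" where
  "lie_ideal \<ii> \<hh> \<longleftrightarrow>
     subspace \<ii> \<and> \<ii> \<subseteq> \<hh> \<and> (\<forall>X\<in>\<hh>. \<forall>Y\<in>\<ii>. bracket X Y \<in> \<ii>)"

text \<open>\<^const>\<open>dim\<close> is 0 on infinite-dimensional spaces, so the dimension equation below
  can only hold for finite-dimensional ones.\<close>

definition ideal_chain :: "'a lie_group \<Rightarrow> nat \<Rightarrow> (nat \<Rightarrow> 'a vfield set) \<Rightarrow> bool" where
  "ideal_chain G n \<hh> \<longleftrightarrow>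
     \<hh> 0 = lie_algebra G \<and> \<hh> n = {0} \<and>
     (\<forall>r\<le>n. lie_subalgebra (\<hh> r) (lie_algebra G)) \<and>
     (\<forall>r\<in>{1..n}. lie_ideal (\<hh> r) (\<hh> (r - 1)) \<and> dim (\<hh> (r - 1)) = dim (\<hh> r) + 1)"

fun derived_series :: "'a vfield set \<Rightarrow> nat \<Rightarrow> 'a vfield set" where
  "derived_series \<hh> 0 = \<hh>"
| "derived_series \<hh> (Suc k) =
     span {bracket X Y | X Y. X \<in> derived_series \<hh> k \<and> Y \<in> derived_series \<hh> k}"

text \<open>A Lie group is called solvable if its Lie algebra is. For connected groups this agrees with
  solvability of the abstract group; in general it is implied by the latter.\<close>

definition solvable_lie_group :: "'a lie_group \<Rightarrow> bool" where
  "solvable_lie_group G \<longleftrightarrow> is_lie_group G \<and> (\<exists>k. derived_series (lie_algebra G) k = {0})"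

section \<open>Left-invariant metrics\<close>

type_synonym 'a metric =
  "'a \<Rightarrow> (('a \<Rightarrow> real) \<Rightarrow> real) \<Rightarrow> (('a \<Rightarrow> real) \<Rightarrow> real) \<Rightarrow> real"

definition riemannian_metric :: "'a lie_group \<Rightarrow> 'a metric \<Rightarrow> bool" where
  "riemannian_metric G m \<longleftrightarrow>
     (\<forall>p\<in>carrier G.
        (\<forall>u\<in>tangent_space G p. \<forall>v\<in>tangent_space G p. m p u v = m p v u) \<and>
        (\<forall>u\<in>tangent_space G p. \<forall>v\<in>tangent_space G p. \<forall>w\<in>tangent_space G p.
           m p (u + v) w = m p u w + m p v w) \<and>
        (\<forall>c. \<forall>u\<in>tangent_space G p. \<forall>v\<in>tangent_space G p. m p (c *\<^sub>R u) v = c * m p u v) \<and>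
        (\<forall>u\<in>tangent_space G p. u \<noteq> 0 \<longrightarrow> m p u u > 0)) \<and>
     (\<forall>X\<in>vector_fields G. \<forall>Y\<in>vector_fields G.
        (\<lambda>p. if p \<in> carrier G then m p (field_at X p) (field_at Y p) else 0) \<in> smooth_funs G)"

definition left_invariant_metric :: "'a lie_group \<Rightarrow> 'a metric \<Rightarrow> bool" where
  "left_invariant_metric G m \<longleftrightarrow>
     riemannian_metric G m \<and>
     (\<forall>a\<in>carrier G. \<forall>p\<in>carrier G. \<forall>u\<in>tangent_space G p. \<forall>v\<in>tangent_space G p.
        m (a \<otimes>\<^bsub>G\<^esub> p) (left_push G a u) (left_push G a v) = m p u v)"

definition lie_inner :: "'a lie_group \<Rightarrow> 'a metric \<Rightarrow> 'a vfield \<Rightarrow> 'a vfield \<Rightarrow> real" where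
  "lie_inner G m X Y = m \<one>\<^bsub>G\<^esub> (field_at X \<one>\<^bsub>G\<^esub>) (field_at Y \<one>\<^bsub>G\<^esub>)"

definition cyclic_metric_lie_group :: "'a lie_group \<Rightarrow> 'a metric \<Rightarrow> bool" where
  "cyclic_metric_lie_group G m \<longleftrightarrow>
     is_lie_group G \<and> left_invariant_metric G m \<and>
     (\<forall>X\<in>lie_algebra G. \<forall>Y\<in>lie_algebra G. \<forall>Z\<in>lie_algebra G.
        lie_inner G m (bracket X Y) Z + lie_inner G m (bracket Y Z) X
          + lie_inner G m (bracket Z X) Y = 0)"

definition orthonormal_basis :: "'a lie_group \<Rightarrow> 'a metric \<Rightarrow> nat \<Rightarrow> (nat \<Rightarrow> 'a vfield) \<Rightarrow> bool" where
  "orthonormal_basis G m n e \<longleftrightarrow>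
     (\<forall>i\<in>{1..n}. e i \<in> lie_algebra G) \<and>
     span (e ` {1..n}) = lie_algebra G \<and>
     (\<forall>i\<in>{1..n}. \<forall>j\<in>{1..n}. lie_inner G m (e i) (e j) = (if i = j then 1 else 0))"

definition adapted :: "nat \<Rightarrow> (nat \<Rightarrow> 'a vfield set) \<Rightarrow> (nat \<Rightarrow> 'a vfield) \<Rightarrow> bool" where
  "adapted n \<hh> e \<longleftrightarrow> (\<forall>i\<in>{1..n}. \<hh> (n - i) = span (e ` {1..i}))"

definition structure_const ::
  "'a lie_group \<Rightarrow> 'a metric \<Rightarrow> (nat \<Rightarrow> 'a vfield) \<Rightarrow> nat \<Rightarrow> nat \<Rightarrow> nat \<Rightarrow> real" where
  "structure_const G m e i j k = lie_inner G m (bracket (e i) (e j)) (e k)"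

definition selfadjoint_on ::
  "'a lie_group \<Rightarrow> 'a metric \<Rightarrow> 'a vfield set \<Rightarrow> ('a vfield \<Rightarrow> 'a vfield) \<Rightarrow> bool" where
  "selfadjoint_on G m \<hh> F \<longleftrightarrow>
     (\<forall>X\<in>\<hh>. F X \<in> \<hh>) \<and>
     (\<forall>X\<in>\<hh>. \<forall>Y\<in>\<hh>. lie_inner G m (F X) Y = lie_inner G m X (F Y))"

abbreviation ad :: "'a vfield \<Rightarrow> 'a vfield \<Rightarrow> 'a vfield" where
  "ad X \<equiv> bracket X"

end

theory Submission
  imports Defs
begin

text \<open>
  Write \<open>D(X,Y,Z)\<close> for the cyclic sum \<open>\<langle>[X,Y],Z\<rangle> + \<langle>[Y,Z],X\<rangle> + \<langle>[Z,X],Y\<rangle>\<close>. It is trilinear and,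
  since the bracket is anticommutative, alternating; hence the metric is cyclic as soon as
  \<open>D(e\<^sub>i,e\<^sub>j,e\<^sub>k) = 0\<close> for \<open>i < j < k\<close>. The chain of ideals makes the structure constants triangular:
  for \<open>i < j\<close> the bracket \<open>[e\<^sub>i,e\<^sub>j]\<close> lies in the span of the \<open>e\<^sub>l\<close> with \<open>l < j\<close>, so orthogonality
  gives \<open>c\<^sub>i\<^sub>j\<^sup>k = 0\<close> for \<open>i < j \<le> k\<close>. Of the three terms of \<open>D(e\<^sub>i,e\<^sub>j,e\<^sub>k)\<close> only
  \<open>c\<^sub>j\<^sub>k\<^sup>i - c\<^sub>i\<^sub>k\<^sup>j\<close> survives, which is the condition on structure constants.

  Selfadjointness of \<open>ad e\<^sub>k\<close> on the span of \<open>e\<^sub>1, \<dots>, e\<^sub>k\<close> is bilinear in the two arguments and so can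
  also be tested on the basis. For indices \<open>i, j < k\<close> it is again the equality \<open>c\<^sub>i\<^sub>k\<^sup>j = c\<^sub>j\<^sub>k\<^sup>i\<close>; if one
  of the two indices is \<open>k\<close>, both sides vanish by triangularity.

  The argument takes place in an arbitrary anticommutative algebra with a symmetric bilinear form,
  in \<open>cyclic_iff_structure_constants\<close> and \<open>structure_constants_iff_selfadjoint\<close>. What remains for
  the Lie algebra of \<open>G\<close> is that the commutator of left-invariant fields and the inner product at
  the identity are bilinear (\<open>lie_algebra_metric_algebra\<close>).
\<close>

section \<open>Functionals that are linear on a subspace\<close>

lemma linear_functional_vanishes_on_span:
  fixes \<phi> :: "'v::real_vector \<Rightarrow> real"
  assumes "subspace L" and "S \<subseteq> L"
    and add: "\<And>x y. x \<in> L \<Longrightarrow> y \<in> L \<Longrightarrow> \<phi> (x + y) = \<phi> x + \<phi> y"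
    and scale: "\<And>c x. x \<in> L \<Longrightarrow> \<phi> (c *\<^sub>R x) = c * \<phi> x"
    and zero: "\<And>s. s \<in> S \<Longrightarrow> \<phi> s = 0"
    and "x \<in> span S"
  shows "\<phi> x = 0"
proof -
  have "\<phi> 0 = 0"
    using scale[of 0 0] subspace_0[OF \<open>subspace L\<close>] by simp
  then have "subspace {x \<in> L. \<phi> x = 0}"
    using \<open>subspace L\<close> by (auto simp: subspace_def add scale)
  then have "span S \<subseteq> {x \<in> L. \<phi> x = 0}"
    using assms(2) zero by (intro span_minimal) auto
  then show ?thesis using \<open>x \<in> span S\<close> by auto
qed

section \<open>Anticommutative algebras with a symmetric bilinear form\<close>

locale metric_algebra =
  fixes L :: "'v::real_vector set"
    and br :: "'v \<Rightarrow> 'v \<Rightarrow> 'v"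
    and ip :: "'v \<Rightarrow> 'v \<Rightarrow> real"
  assumes subspace: "subspace L"
    and br_closed: "X \<in> L \<Longrightarrow> Y \<in> L \<Longrightarrow> br X Y \<in> L"
    and br_anticomm: "X \<in> L \<Longrightarrow> Y \<in> L \<Longrightarrow> br X Y = - br Y X"
    and br_add_left: "X \<in> L \<Longrightarrow> Y \<in> L \<Longrightarrow> Z \<in> L \<Longrightarrow> br (X + Y) Z = br X Z + br Y Z"
    and br_scale_left: "X \<in> L \<Longrightarrow> Z \<in> L \<Longrightarrow> br (c *\<^sub>R X) Z = c *\<^sub>R br X Z"
    and ip_commute: "X \<in> L \<Longrightarrow> Y \<in> L \<Longrightarrow> ip X Y = ip Y X"
    and ip_add_left: "X \<in> L \<Longrightarrow> Y \<in> L \<Longrightarrow> Z \<in> L \<Longrightarrow> ip (X + Y) Z = ip X Z + ip Y Z"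
    and ip_scale_left: "X \<in> L \<Longrightarrow> Z \<in> L \<Longrightarrow> ip (c *\<^sub>R X) Z = c * ip X Z"
begin

lemmas add_closed = subspace_add[OF subspace]
  and scale_closed = subspace_scale[OF subspace]

lemma br_add_right:
  "X \<in> L \<Longrightarrow> Y \<in> L \<Longrightarrow> Z \<in> L \<Longrightarrow> br Z (X + Y) = br Z X + br Z Y"
  using br_anticomm[of Z "X + Y"] br_anticomm[of Z X] br_anticomm[of Z Y] br_add_left[of X Y Z]
  by (simp add: add_closed)

lemma br_scale_right: "X \<in> L \<Longrightarrow> Z \<in> L \<Longrightarrow> br Z (c *\<^sub>R X) = c *\<^sub>R br Z X"
  using br_anticomm[of Z "c *\<^sub>R X"] br_anticomm[of Z X] br_scale_left[of X Z c]
  by (simp add: scale_closed)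

lemma br_self: assumes "X \<in> L" shows "br X X = 0"
proof -
  have "br X X + br X X = 0" using br_anticomm[OF assms assms] by (metis add.right_inverse)
  then have "2 *\<^sub>R br X X = 0" by (simp add: scaleR_2)
  then show ?thesis by simp
qed

lemma ip_add_right: "X \<in> L \<Longrightarrow> Y \<in> L \<Longrightarrow> Z \<in> L \<Longrightarrow> ip Z (X + Y) = ip Z X + ip Z Y"
  using ip_commute[of Z "X + Y"] ip_commute[of Z X] ip_commute[of Z Y] ip_add_left[of X Y Z]
  by (simp add: add_closed)

lemma ip_scale_right: "X \<in> L \<Longrightarrow> Z \<in> L \<Longrightarrow> ip Z (c *\<^sub>R X) = c * ip Z X"
  using ip_commute[of Z "c *\<^sub>R X"] ip_commute[of Z X] ip_scale_left[of X Z c]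
  by (simp add: scale_closed)

lemma ip_neg_left: "X \<in> L \<Longrightarrow> Z \<in> L \<Longrightarrow> ip (- X) Z = - ip X Z"
  using ip_scale_left[of X Z "-1"] by simp

lemma ip_zero_left: "Z \<in> L \<Longrightarrow> ip 0 Z = 0"
  using ip_scale_left[of Z Z 0] by simp

lemma ip_br_swap: "X \<in> L \<Longrightarrow> Y \<in> L \<Longrightarrow> Z \<in> L \<Longrightarrow> ip (br X Y) Z = - ip (br Y X) Z"
  using br_anticomm[of X Y] ip_neg_left[of "br Y X" Z] by (simp add: br_closed)

definition cyclic_sum :: "'v \<Rightarrow> 'v \<Rightarrow> 'v \<Rightarrow> real" where
  "cyclic_sum X Y Z = ip (br X Y) Z + ip (br Y Z) X + ip (br Z X) Y"

lemma cyclic_sum_rotate: "cyclic_sum X Y Z = cyclic_sum Y Z X"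
  by (simp add: cyclic_sum_def)

lemma cyclic_sum_swap:
  "X \<in> L \<Longrightarrow> Y \<in> L \<Longrightarrow> Z \<in> L \<Longrightarrow> cyclic_sum Y X Z = - cyclic_sum X Y Z"
  using ip_br_swap[of Y X Z] ip_br_swap[of X Z Y] ip_br_swap[of Z Y X]
  by (simp add: cyclic_sum_def)

lemma cyclic_sum_repeated: "X \<in> L \<Longrightarrow> Z \<in> L \<Longrightarrow> cyclic_sum X X Z = 0"
  using cyclic_sum_swap[of X X Z] by simp

lemma cyclic_sum_add:
  "X \<in> L \<Longrightarrow> X' \<in> L \<Longrightarrow> Y \<in> L \<Longrightarrow> Z \<in> L \<Longrightarrow>
   cyclic_sum (X + X') Y Z = cyclic_sum X Y Z + cyclic_sum X' Y Z"
  by (simp add: cyclic_sum_def br_add_left br_add_right ip_add_left ip_add_right br_closed)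

lemma cyclic_sum_scale:
  "X \<in> L \<Longrightarrow> Y \<in> L \<Longrightarrow> Z \<in> L \<Longrightarrow> cyclic_sum (c *\<^sub>R X) Y Z = c * cyclic_sum X Y Z"
  by (simp add: cyclic_sum_def br_scale_left br_scale_right ip_scale_left ip_scale_right br_closed
      algebra_simps)

text \<open>By rotation invariance, linearity in the first argument is linearity in each, so the three
  arguments can be replaced by spanning vectors one after the other.\<close>

lemma cyclic_sum_vanishes_on_span:
  assumes "S \<subseteq> L"
    and basis: "\<And>x y z. x \<in> S \<Longrightarrow> y \<in> S \<Longrightarrow> z \<in> S \<Longrightarrow> cyclic_sum x y z = 0"
    and "X \<in> span S" "Y \<in> span S" "Z \<in> span S"
  shows "cyclic_sum X Y Z = 0"
proof -
  have span: "span S \<subseteq> L" using assms(1) subspace by (simp add: span_minimal)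
  have first: "cyclic_sum x y z = 0"
    if "y \<in> L" "z \<in> L" "\<And>s. s \<in> S \<Longrightarrow> cyclic_sum s y z = 0" "x \<in> span S" for x y z
    by (rule linear_functional_vanishes_on_span[OF subspace assms(1), of "\<lambda>x. cyclic_sum x y z"])
      (use that in \<open>auto simp: cyclic_sum_add cyclic_sum_scale\<close>)
  have one: "cyclic_sum x y z = 0" if "x \<in> span S" "y \<in> S" "z \<in> S" for x y z
    by (rule first) (use that assms(1) basis in auto)
  have two: "cyclic_sum x y z = 0" if "x \<in> span S" "y \<in> span S" "z \<in> S" for x y z
  proof -
    have "cyclic_sum y z x = 0"
    proof (rule first)
      show "cyclic_sum s z x = 0" if "s \<in> S" for s
        using one[OF \<open>x \<in> span S\<close> that \<open>z \<in> S\<close>] by (simp add: cyclic_sum_rotate[of x])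
    qed (use that span assms(1) in auto)
    then show ?thesis by (simp add: cyclic_sum_rotate[of x])
  qed
  have "cyclic_sum Z X Y = 0"
  proof (rule first)
    show "cyclic_sum s X Y = 0" if "s \<in> S" for s
      using two[OF assms(3,4) that] by (simp add: cyclic_sum_rotate[of s])
  qed (use assms(3-5) span in auto)
  then show ?thesis by (simp add: cyclic_sum_rotate[of Z])
qed

end

section \<open>Triangular orthogonal bases\<close>

text \<open>The last assumption says that \<open>span {e\<^sub>1, \<dots>, e\<^sub>j\<^sub>-\<^sub>1}\<close> is an ideal in \<open>span {e\<^sub>1, \<dots>, e\<^sub>j}\<close>, as far
  as this is visible on basis vectors.\<close>

locale triangular_metric_algebra = metric_algebra +
  fixes e :: "nat \<Rightarrow> 'a" and n :: nat
  assumes basis_span: "span (e ` {1..n}) = L"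
    and orthogonal: "i \<in> {1..n} \<Longrightarrow> j \<in> {1..n} \<Longrightarrow> i \<noteq> j \<Longrightarrow> ip (e i) (e j) = 0"
    and triangular: "1 \<le> i \<Longrightarrow> i < j \<Longrightarrow> j \<le> n \<Longrightarrow> br (e i) (e j) \<in> span (e ` {1..<j})"
begin

abbreviation c :: "nat \<Rightarrow> nat \<Rightarrow> nat \<Rightarrow> real" where
  "c i j k \<equiv> ip (br (e i) (e j)) (e k)"

lemma basis_in: "i \<in> {1..n} \<Longrightarrow> e i \<in> L"
  unfolding basis_span[symmetric] by (intro span_base imageI)

lemma c_swap: "i \<in> {1..n} \<Longrightarrow> j \<in> {1..n} \<Longrightarrow> k \<in> {1..n} \<Longrightarrow> c i j k = - c j i k"
  by (intro ip_br_swap basis_in)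

lemma c_self: "i \<in> {1..n} \<Longrightarrow> k \<in> {1..n} \<Longrightarrow> c i i k = 0"
  by (simp add: br_self ip_zero_left basis_in)

lemma c_triangular:
  assumes "1 \<le> i" "i < j" "j \<le> k" "k \<le> n"
  shows "c i j k = 0"
proof (rule linear_functional_vanishes_on_span[OF subspace, of "e ` {1..<j}" "\<lambda>x. ip x (e k)"])
  show "br (e i) (e j) \<in> span (e ` {1..<j})" using assms by (intro triangular) auto
qed (use assms in \<open>auto intro: basis_in orthogonal simp: ip_add_left ip_scale_left basis_in\<close>)

lemma cyclic_sum_basis:
  assumes "1 \<le> i" "i < j" "j < k" "k \<le> n"
  shows "cyclic_sum (e i) (e j) (e k) = c j k i - c i k j"
  using assms c_triangular[of i j k] c_swap[of k i j] by (simp add: cyclic_sum_def)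

theorem cyclic_iff_structure_constants:
  "(\<forall>X\<in>L. \<forall>Y\<in>L. \<forall>Z\<in>L. cyclic_sum X Y Z = 0) \<longleftrightarrow>
   (\<forall>i j k. 1 \<le> i \<and> i < j \<and> j < k \<and> k \<le> n \<longrightarrow> c i k j = c j k i)"
  (is "?cyclic \<longleftrightarrow> ?structure")
proof
  assume ?cyclic
  show ?structure
  proof (intro allI impI)
    fix i j k assume ijk: "1 \<le> i \<and> i < j \<and> j < k \<and> k \<le> n"
    then have "cyclic_sum (e i) (e j) (e k) = 0" using \<open>?cyclic\<close> by (simp add: basis_in)
    then show "c i k j = c j k i" using cyclic_sum_basis[of i j k] ijk by simp
  qed
next
  assume ?structure
  have sorted: "cyclic_sum (e i) (e j) (e k) = 0"
    if "1 \<le> i" "i < j" "j < k" "k \<le> n" for i j k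
  proof -
    have "c i k j = c j k i" using that \<open>?structure\<close> by blast
    then show ?thesis using cyclic_sum_basis[OF that] by simp
  qed
  \<comment> \<open>A rotation brings the largest index to the last place; after that one transposition suffices.\<close>
  have last_max: "cyclic_sum (e i) (e j) (e k) = 0"
    if ijk: "i \<in> {1..n}" "j \<in> {1..n}" "k \<in> {1..n}" and le: "i \<le> k" "j \<le> k" for i j k
  proof -
    note in_L = basis_in[OF ijk(1)] basis_in[OF ijk(2)] basis_in[OF ijk(3)]
    note rotate = cyclic_sum_rotate[of "e i" "e j" "e k"] cyclic_sum_rotate[of "e k" "e i" "e j"]
    consider "i = j" | "j = k" | "i = k" | "i < j" "j < k" | "j < i" "i < k"
      using le by linarith
    then show ?thesis
    proof cases
      case 1
      then show ?thesis using cyclic_sum_repeated[OF in_L(1,3)] by simp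
    next
      case 2
      then show ?thesis using cyclic_sum_repeated[OF in_L(2,1)] rotate by simp
    next
      case 3
      then show ?thesis using cyclic_sum_repeated[OF in_L(3,2)] rotate by simp
    next
      case 4
      then show ?thesis using ijk by (intro sorted) auto
    next
      case 5
      then have "cyclic_sum (e j) (e i) (e k) = 0" using ijk by (intro sorted) auto
      then show ?thesis using cyclic_sum_swap[OF in_L] by simp
    qed
  qed
  have basis: "cyclic_sum (e i) (e j) (e k) = 0"
    if ijk: "i \<in> {1..n}" "j \<in> {1..n}" "k \<in> {1..n}" for i j k
  proof -
    note rotate = cyclic_sum_rotate[of "e i" "e j" "e k"] cyclic_sum_rotate[of "e k" "e i" "e j"]
    consider "i \<le> k" "j \<le> k" | "j \<le> i" "k \<le> i" | "k \<le> j" "i \<le> j" by linarith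
    then show ?thesis
    proof cases
      case 1
      then show ?thesis using last_max[OF ijk] by simp
    next
      case 2
      then show ?thesis using last_max[OF ijk(2,3,1)] rotate by simp
    next
      case 3
      then show ?thesis using last_max[OF ijk(3,1,2)] rotate by simp
    qed
  qed
  show ?cyclic
  proof (intro ballI)
    fix X Y Z assume "X \<in> L" "Y \<in> L" "Z \<in> L"
    then have "X \<in> span (e ` {1..n})" "Y \<in> span (e ` {1..n})" "Z \<in> span (e ` {1..n})"
      unfolding basis_span .
    then show "cyclic_sum X Y Z = 0"
      by (rule cyclic_sum_vanishes_on_span[rotated 2]) (use basis basis_in in auto)
  qed
qed

theorem structure_constants_iff_selfadjoint:
  "(\<forall>i j k. 1 \<le> i \<and> i < j \<and> j < k \<and> k \<le> n \<longrightarrow> c i k j = c j k i) \<longleftrightarrow>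
   (\<forall>k\<in>{1..n}. \<forall>X\<in>span (e ` {1..k}). \<forall>Y\<in>span (e ` {1..k}).
      ip (br (e k) X) Y = ip X (br (e k) Y))"
  (is "?structure \<longleftrightarrow> ?selfadjoint")
proof
  assume ?structure
  have basis: "c k i j = c k j i" if ijk: "i \<in> {1..k}" "j \<in> {1..k}" "k \<in> {1..n}" for i j k
  proof -
    have less: "c k i j = c k j i" if "1 \<le> i" "i < j" "j \<le> k" "k \<le> n" for i j k
      \<comment> \<open>For \<open>j = k\<close> both sides are zero: the left one by triangularity, the right one because
        \<open>[e\<^sub>k, e\<^sub>k] = 0\<close>.\<close>
    proof (cases "j = k")
      case True
      then show ?thesis
        using that c_triangular[of i k k] c_swap[of k i k] c_self[of k i] by simp
    next
      case False
      then have "c i k j = c j k i" using that \<open>?structure\<close> by (metis le_neq_implies_less)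
      then show ?thesis using that c_swap[of k i j] c_swap[of k j i] by simp
    qed
    show ?thesis using less[of i j k] less[of j i k] ijk by (cases i j rule: linorder_cases) auto
  qed
  show ?selfadjoint
  proof (intro ballI)
    fix k X Y assume k: "k \<in> {1..n}" and X: "X \<in> span (e ` {1..k})" and Y: "Y \<in> span (e ` {1..k})"
    have S: "e ` {1..k} \<subseteq> L" using k by (auto intro: basis_in)
    then have "span (e ` {1..k}) \<subseteq> L" by (simp add: span_minimal subspace)
    then have XY: "X \<in> L" "Y \<in> L" using X Y by auto
    note bilinear = br_add_right br_scale_right ip_add_left ip_scale_left ip_add_right
      ip_scale_right br_closed basis_in[OF k] algebra_simps
    have "ip (br (e k) x) Y - ip x (br (e k) Y) = 0" if x: "x \<in> e ` {1..k}" for x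
    proof (rule linear_functional_vanishes_on_span[OF subspace S, where x = Y])
      fix y assume y: "y \<in> e ` {1..k}"
      obtain i j where ij: "x = e i" "y = e j" "i \<in> {1..k}" "j \<in> {1..k}" using x y by auto
      have "ip (e i) (br (e k) (e j)) = c k j i"
        using ij k by (intro ip_commute br_closed basis_in) auto
      then show "ip (br (e k) x) y - ip x (br (e k) y) = 0" using basis[of i k j] ij k by simp
    qed (use x S Y in \<open>auto simp: bilinear\<close>)
    then have "ip (br (e k) X) Y - ip X (br (e k) Y) = 0"
      by (rule linear_functional_vanishes_on_span[OF subspace S, where x = X, rotated 2])
        (use X XY in \<open>auto simp: bilinear\<close>)
    then show "ip (br (e k) X) Y = ip X (br (e k) Y)" by simp
  qed
next
  assume adj: ?selfadjoint
  show ?structure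
  proof (intro allI impI)
    fix i j k assume ijk: "1 \<le> i \<and> i < j \<and> j < k \<and> k \<le> n"
    then have "c k i j = ip (e i) (br (e k) (e j))"
      using adj by (simp add: span_base)
    also have "\<dots> = c k j i"
      using ijk by (intro ip_commute br_closed basis_in) auto
    finally show "c i k j = c j k i"
      using ijk c_swap[of k i j] c_swap[of k j i] by simp
  qed
qed

end

section \<open>Bilinearity for left-invariant vector fields\<close>

lemma vector_field_smooth: "X \<in> vector_fields G \<Longrightarrow> f \<in> smooth_funs G \<Longrightarrow> X f \<in> smooth_funs G"
  by (simp add: vector_fields_def)

lemma vector_field_off_smooth: "X \<in> vector_fields G \<Longrightarrow> f \<notin> smooth_funs G \<Longrightarrow> X f = 0"
  by (simp add: vector_fields_def)

text \<open>A field maps every function to one that vanishes off the carrier, so the derivation laws of its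
  tangent vectors at the points of the group already make the operator itself linear.\<close>

lemma vector_field_off_carrier:
  assumes "X \<in> vector_fields G" "p \<notin> carrier G"
  shows "X f p = 0"
proof (cases "f \<in> smooth_funs G")
  case True
  then have "X f \<in> smooth_funs G" by (rule vector_field_smooth[OF assms(1)])
  then show ?thesis using assms(2) by (simp add: smooth_funs_def)
qed (simp add: vector_field_off_smooth[OF assms(1)])

lemma vector_field_add:
  assumes X: "X \<in> vector_fields G" and "f \<in> smooth_funs G" "g \<in> smooth_funs G"
  shows "X (f + g) = X f + X g"
proof
  fix p
  show "X (f + g) p = (X f + X g) p"
  proof (cases "p \<in> carrier G")
    case True
    then have "field_at X p \<in> tangent_space G p" using X by (simp add: vector_fields_def)
    then show ?thesis using assms by (simp add: tangent_space_def field_at_def)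
  qed (simp add: vector_field_off_carrier[OF X])
qed

lemma vector_field_scale:
  assumes X: "X \<in> vector_fields G" and "f \<in> smooth_funs G"
  shows "X (c *\<^sub>R f) = c *\<^sub>R X f"
proof
  fix p
  show "X (c *\<^sub>R f) p = (c *\<^sub>R X f) p"
  proof (cases "p \<in> carrier G")
    case True
    then have "field_at X p \<in> tangent_space G p" using X by (simp add: vector_fields_def)
    then show ?thesis using assms by (simp add: tangent_space_def field_at_def scaleR_fun_def)
  qed (simp add: vector_field_off_carrier[OF X] scaleR_fun_def)
qed

lemma vector_field_zero:
  assumes "X \<in> vector_fields G"
  shows "X 0 = 0"
proof (cases "0 \<in> smooth_funs G")
  case True
  then show ?thesis using vector_field_scale[OF assms, of 0 0] by simp
qed (use assms in \<open>simp add: vector_fields_def\<close>)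

lemma bracket_add_left:
  assumes "X \<in> vector_fields G" "X' \<in> vector_fields G" "Y \<in> vector_fields G"
  shows "bracket (X + X') Y = bracket X Y + bracket X' Y"
proof
  fix f
  have "Y (X f + X' f) = Y (X f) + Y (X' f)"
  proof (cases "f \<in> smooth_funs G")
    case True
    show ?thesis
      by (rule vector_field_add[OF assms(3) vector_field_smooth[OF assms(1) True]
            vector_field_smooth[OF assms(2) True]])
  next
    case False
    show ?thesis
      by (simp only: vector_field_off_smooth[OF assms(1) False]
          vector_field_off_smooth[OF assms(2) False] vector_field_zero[OF assms(3)] add_0)
  qed
  then show "bracket (X + X') Y f = (bracket X Y + bracket X' Y) f"
    by (simp add: bracket_def)
qed

lemma bracket_scale_left:
  assumes "X \<in> vector_fields G" "Y \<in> vector_fields G"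
  shows "bracket (c *\<^sub>R X) Y = c *\<^sub>R bracket X Y"
proof
  fix f
  have "Y (c *\<^sub>R X f) = c *\<^sub>R Y (X f)"
  proof (cases "f \<in> smooth_funs G")
    case True
    show ?thesis
      by (rule vector_field_scale[OF assms(2) vector_field_smooth[OF assms(1) True]])
  next
    case False
    show ?thesis
      by (simp only: vector_field_off_smooth[OF assms(1) False] vector_field_zero[OF assms(2)]
          scaleR_zero_right)
  qed
  moreover have "(c *\<^sub>R X) g = c *\<^sub>R X g" for g by (simp add: scaleR_fun_def[of c X])
  ultimately show "bracket (c *\<^sub>R X) Y f = (c *\<^sub>R bracket X Y) f"
    by (simp add: bracket_def scaleR_fun_def[of c "\<lambda>f. X (Y f) - Y (X f)"] scaleR_diff_right)
qed

lemma lie_algebra_vector_field: "X \<in> lie_algebra G \<Longrightarrow> X \<in> vector_fields G"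
  by (simp add: lie_algebra_def)

lemma field_at_tangent:
  "X \<in> lie_algebra G \<Longrightarrow> p \<in> carrier G \<Longrightarrow> field_at X p \<in> tangent_space G p"
  by (simp add: lie_algebra_def vector_fields_def)

lemma field_at_add: "field_at (X + Y) p = field_at X p + field_at Y p"
  by (simp add: field_at_def fun_eq_iff)

lemma field_at_scale: "field_at (c *\<^sub>R X) p = c *\<^sub>R field_at X p"
  by (simp add: field_at_def fun_eq_iff scaleR_fun_def)

lemma lie_algebra_metric_algebra:
  assumes "\<one>\<^bsub>G\<^esub> \<in> carrier G" and "riemannian_metric G m"
    and sub: "lie_subalgebra (lie_algebra G) (lie_algebra G)"
  shows "metric_algebra (lie_algebra G) bracket (lie_inner G m)"
proof
  show "subspace (lie_algebra G)" using sub by (simp add: lie_subalgebra_def)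
  fix X Y Z c assume X: "X \<in> lie_algebra G" and Z: "Z \<in> lie_algebra G"
  note tangent = field_at_tangent[OF _ assms(1)]
  note metric = assms(2)[unfolded riemannian_metric_def, THEN conjunct1, rule_format, OF assms(1)]
  show "bracket (c *\<^sub>R X) Z = c *\<^sub>R bracket X Z"
    using X Z by (intro bracket_scale_left lie_algebra_vector_field)
  show "lie_inner G m (c *\<^sub>R X) Z = c * lie_inner G m X Z"
    using metric tangent[OF X] tangent[OF Z] by (simp add: lie_inner_def field_at_scale)
  assume Y: "Y \<in> lie_algebra G"
  show "bracket X Y \<in> lie_algebra G" using sub X Y by (simp add: lie_subalgebra_def)
  show "bracket X Y = - bracket Y X" by (simp add: bracket_def fun_eq_iff)
  show "bracket (X + Y) Z = bracket X Z + bracket Y Z"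
    using X Y Z by (intro bracket_add_left lie_algebra_vector_field)
  show "lie_inner G m X Y = lie_inner G m Y X"
    using metric tangent[OF X] tangent[OF Y] by (simp add: lie_inner_def)
  show "lie_inner G m (X + Y) Z = lie_inner G m X Z + lie_inner G m Y Z"
    using metric tangent[OF X] tangent[OF Y] tangent[OF Z]
    by (simp add: lie_inner_def field_at_add)
qed

section \<open>Cyclic metrics on solvable Lie groups\<close>

theorem proposition5p1:
  fixes G :: "'a lie_group" and m :: "'a metric" and n :: nat
    and \<gg> :: "nat \<Rightarrow> 'a vfield set" and e :: "nat \<Rightarrow> 'a vfield"
  assumes "solvable_lie_group G" and "dimen G = n"
    and "left_invariant_metric G m"
    and "ideal_chain G n \<gg>"
    and "orthonormal_basis G m n e" and "adapted n \<gg> e"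
  shows "(cyclic_metric_lie_group G m \<longleftrightarrow>
            (\<forall>i j k. 1 \<le> i \<and> i < j \<and> j < k \<and> k \<le> n \<longrightarrow>
               structure_const G m e i k j = structure_const G m e j k i))
       \<and> (cyclic_metric_lie_group G m \<longleftrightarrow>
            (\<forall>i\<in>{1..n}. selfadjoint_on G m (\<gg> (n - i)) (ad (e i))))"
proof -
  have lie: "is_lie_group G" using assms(1) by (simp add: solvable_lie_group_def)
  then have one: "\<one>\<^bsub>G\<^esub> \<in> carrier G"
    by (simp add: is_lie_group_def group.is_monoid monoid.one_closed)
  have riemannian: "riemannian_metric G m" using assms(3) by (simp add: left_invariant_metric_def)
  have subalgebra: "lie_subalgebra (\<gg> r) (lie_algebra G)" if "r \<le> n" for r
    using assms(4) that by (simp add: ideal_chain_def)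
  have flag: "\<gg> (n - i) = span (e ` {1..i})" if "i \<le> n" for i
    using assms(4,6) that by (cases "i = 0") (auto simp: ideal_chain_def adapted_def)
  interpret metric_algebra "lie_algebra G" bracket "lie_inner G m"
    using subalgebra[of 0] assms(4)
    by (intro lie_algebra_metric_algebra one riemannian) (simp add: ideal_chain_def)
  interpret triangular_metric_algebra "lie_algebra G" bracket "lie_inner G m" e n
  proof
    show "span (e ` {1..n}) = lie_algebra G" using assms(5) by (simp add: orthonormal_basis_def)
    show "lie_inner G m (e i) (e j) = 0" if "i \<in> {1..n}" "j \<in> {1..n}" "i \<noteq> j" for i j
      using assms(5) that by (simp add: orthonormal_basis_def)
    fix i j assume ij: "1 \<le> i" "i < j" "j \<le> n"
    \<comment> \<open>The ideal of index \<open>n - (j - 1)\<close> contains \<open>e\<^sub>i\<close>, and its predecessor in the chain is the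
      span of \<open>e\<^sub>1, \<dots>, e\<^sub>j\<close>.\<close>
    have flag_pred: "\<gg> (n - (j - 1)) = span (e ` {1..j - 1})"
      using ij by (intro flag) simp
    have "lie_ideal (\<gg> (n - (j - 1))) (\<gg> (n - j))"
    proof -
      have "n - (j - 1) \<in> {1..n}" "n - (j - 1) - 1 = n - j" using ij by auto
      then show ?thesis using assms(4) unfolding ideal_chain_def by metis
    qed
    moreover have "e i \<in> \<gg> (n - (j - 1))" "e j \<in> \<gg> (n - j)"
      using ij unfolding flag_pred flag[OF ij(3)] by (auto intro!: span_base)
    ultimately have "bracket (e j) (e i) \<in> \<gg> (n - (j - 1))" by (simp add: lie_ideal_def)
    then have "- bracket (e j) (e i) \<in> span (e ` {1..j - 1})"
      unfolding flag_pred by (rule span_neg)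
    moreover have "- bracket (e j) (e i) = bracket (e i) (e j)"
      by (simp add: bracket_def fun_eq_iff)
    moreover have "{1..j - 1} = {1..<j}" using ij by auto
    ultimately show "bracket (e i) (e j) \<in> span (e ` {1..<j})" by simp
  qed
  have cyclic: "cyclic_metric_lie_group G m \<longleftrightarrow>
      (\<forall>X\<in>lie_algebra G. \<forall>Y\<in>lie_algebra G. \<forall>Z\<in>lie_algebra G. cyclic_sum X Y Z = 0)"
    using lie assms(3) by (simp add: cyclic_metric_lie_group_def cyclic_sum_def)
  have invariant: "\<forall>X\<in>\<gg> (n - i). bracket (e i) X \<in> \<gg> (n - i)" if "i \<in> {1..n}" for i
  proof -
    have "e i \<in> \<gg> (n - i)" using that by (auto simp: flag intro!: span_base)
    then show ?thesis using subalgebra[of "n - i"] by (simp add: lie_subalgebra_def)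
  qed
  have selfadjoint: "(\<forall>i\<in>{1..n}. selfadjoint_on G m (\<gg> (n - i)) (ad (e i))) \<longleftrightarrow>
      (\<forall>i\<in>{1..n}. \<forall>X\<in>span (e ` {1..i}). \<forall>Y\<in>span (e ` {1..i}).
         lie_inner G m (bracket (e i) X) Y = lie_inner G m X (bracket (e i) Y))"
    using invariant by (intro ball_cong refl) (simp add: selfadjoint_on_def flag)
  show ?thesis
    unfolding cyclic selfadjoint structure_const_def
    using cyclic_iff_structure_constants structure_constants_iff_selfadjoint by simp
qed

end
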